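(* Let $\mathbf{x}_1,\ldots,\mathbf{x}_p\in\mathbb{R}^n$ be covariate vectors with $\|\mathbf{x}_j\|_2=n^{1/2}$, where $p=p_n$, and let $s=s_n$ be a positive integer less than half of the spark of the $n\times p$ matrix $(\mathbf{x}_1,\ldots,\mathbf{x}_p)$. Assume that any two distinct members of the collection $\mathcal{A}_s$ of all $\binom{p}{s}$ subspaces spanned by $s$ of the $\mathbf{x}_j$'s have maximum chordal distance at least a fixed constant $2\delta\in(0,1)$, and that $s/n\to\gamma\in(0,1/2)$ as $n\to\infty$. Then $$\log p\lesssim(\log\delta^{-1})(1-\gamma)n+2\log n+O(1)\qquad\text{as } n\to\infty.$$
   Context: The spark $\kappa$ of an $n\times p$ matrix is the smallest positive integer $\kappa$ such that there is a singular $n\times\kappa$ submatrix, i.e. some $\kappa$ of its columns are linearly dependent. Since $s<\kappa/2$, every subspace spanned by $s$ of the $\mathbf{x}_j$'s is $s$-dimensional and different $s$-subsets span different subspaces, so $|\mathcal{A}_s|=\binom{p}{s}$. For two $s$-dimensional subspaces $V_1,V_2$ of $\mathbb{R}^n$ with principal angles $\pi/2\ge\theta_1\ge\cdots\ge\theta_s\ge0$, the maximum chordal distance is $d_m(V_1,V_2)=\sin\theta_1=\max_{1\le i\le s}\sin\theta_i$; equivalently $d_m(V_1,V_2)=\|P_1-P_2\|_2$ (spectral norm), where $P_i$ is the orthogonal projection onto $V_i$. $\lesssim$ denotes asymptotic dominance: $a_n\lesssim b_n$ means $a_n\le(1+o(1))\,b_n$ as $n\to\infty$. $O(1)$ denotes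 a bounded quantity as $n\to\infty$. *)

theory Defs
  imports
    "Jordan_Normal_Form.DL_Rank_Submatrix"
    "HOL-Library.Landau_Symbols"
    "HOL-Library.Extended_Nat"
begin

definition l2_norm_vec :: "real vec \<Rightarrow> real" where
  "l2_norm_vec v = sqrt (v \<bullet> v)"

text \<open>The selected columns are indexed by a set of column indices, so a repeated column makes the
  submatrix singular. The value is \<open>\<infinity>\<close> if the columns of \<open>A\<close> are linearly independent.\<close>

definition spark :: "real mat \<Rightarrow> enat" where
  "spark A = (INF \<kappa> \<in> {\<kappa>::nat. \<kappa> > 0 \<and>
     (\<exists>J \<subseteq> {..<dim_col A}. card J = \<kappa> \<and>
        vec_space.rank (dim_row A) (submatrix A UNIV J) < \<kappa>)}. enat \<kappa>)"

definition spanned_subspaces :: "nat \<Rightarrow> real mat \<Rightarrow> real vec set set" where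
  "spanned_subspaces s A =
     {vec_space.col_space (dim_row A) (submatrix A UNIV J) | J. J \<subseteq> {..<dim_col A} \<and> card J = s}"

text \<open>Here \<open>V\<close> and \<open>W\<close> are \<open>s\<close>-dimensional subspaces. The pairs of principal vectors are produced by
  the usual successive maximization, so the angles \<open>arccos (u i \<bullet> v i)\<close> increase with \<open>i\<close>;
  \<open>\<theta>\<^sub>1\<close>, the largest angle, is the one at \<open>i = s - 1\<close>.\<close>

definition principal_vectors ::
  "nat \<Rightarrow> real vec set \<Rightarrow> real vec set \<Rightarrow> (nat \<Rightarrow> real vec) \<Rightarrow> (nat \<Rightarrow> real vec) \<Rightarrow> bool" where
  "principal_vectors s V W u v \<longleftrightarrow>
     (\<forall>i<s. let U = {a \<in> V. l2_norm_vec a = 1 \<and> (\<forall>j<i. a \<bullet> u j = 0)};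
                Z = {b \<in> W. l2_norm_vec b = 1 \<and> (\<forall>j<i. b \<bullet> v j = 0)}
            in u i \<in> U \<and> v i \<in> Z \<and> (\<forall>a\<in>U. \<forall>b\<in>Z. a \<bullet> b \<le> u i \<bullet> v i))"

text \<open>Principal vectors are not unique, but the principal angles do not depend on their choice. The
  angles are listed in decreasing order.\<close>

definition principal_angles :: "nat \<Rightarrow> real vec set \<Rightarrow> real vec set \<Rightarrow> real list" where
  "principal_angles s V W =
     (SOME \<theta>s. \<exists>u v. principal_vectors s V W u v \<and>
        \<theta>s = rev (map (\<lambda>i. arccos (u i \<bullet> v i)) [0..<s]))"

definition max_chordal_distance :: "nat \<Rightarrow> real vec set \<Rightarrow> real vec set \<Rightarrow> real" where
  "max_chordal_distance s V W = Max (sin ` set (principal_angles s V W))"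

definition asymp_dominated :: "(nat \<Rightarrow> real) \<Rightarrow> (nat \<Rightarrow> real) \<Rightarrow> bool" where
  "asymp_dominated a b \<longleftrightarrow>
     (\<exists>\<epsilon> \<in> o(\<lambda>_. 1). eventually (\<lambda>n. a n \<le> (1 + \<epsilon> n) * b n) sequentially)"

end

theory Submission
  imports "HOL-Analysis.Ball_Volume" "HOL-Real_Asymp.Real_Asymp" Defs
begin

text \<open>
  Only pairs of subspaces that share \<open>s - 1\<close> of the covariates are needed. Let \<open>W\<close> be the span of
  the first \<open>s - 1\<close> columns and, for every other column, let \<open>e\<^sub>i\<close> be its normalised component
  orthogonal to \<open>W\<close>. The subspaces \<open>W + \<real> e\<^sub>i\<close> and \<open>W + \<real> e\<^sub>j\<close> have all principal angles zero except
  one, which is the angle between the lines \<open>\<real> e\<^sub>i\<close> and \<open>\<real> e\<^sub>j\<close>. So the \<open>e\<^sub>i\<close> are \<open>p - s + 1\<close> unit vectors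
  in the space orthogonal to \<open>W\<close>, of dimension \<open>d = n - s + 1\<close>, with \<open>(e\<^sub>i \<bullet> e\<^sub>j)\<^sup>2 \<le> 1 - 4 \<delta>\<^sup>2\<close>.

  Balls of radius \<open>r\<close> around these vectors are disjoint for \<open>r\<^sup>2 = \<delta>\<^sup>2 / (1 - \<delta>\<^sup>2)\<close>, and the half of each
  ball that faces the origin lies in the ball of radius \<open>sqrt (1 + r\<^sup>2) = r / \<delta>\<close>. Comparing volumes
  gives \<open>p - s + 1 \<le> 2 \<delta>\<^sup>-\<^sup>d\<close>, and \<open>d \<sim> (1 - \<gamma>) n\<close>.
\<close>

section \<open>Packing unit vectors\<close>

text \<open>A finite product measure is determined by its values on boxes, and the preimage of a box
  is a box whose sides have unchanged measure. It serves for translations and the reflection of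
  Lebesgue measure on functions over a finite index set, where the dimension may be a variable
  number.\<close>

lemma (in product_sigma_finite) distr_PiM_componentwise:
  assumes "finite I"
    and meas: "\<And>i. i \<in> I \<Longrightarrow> g i \<in> measurable (M i) (M i)"
    and pres: "\<And>i. i \<in> I \<Longrightarrow> distr (M i) (M i) (g i) = M i"
  shows "distr (PiM I M) (PiM I M) (\<lambda>f. \<lambda>i\<in>I. g i (f i)) = PiM I M"
proof (rule PiM_eqI[OF \<open>finite I\<close>])
  have T: "(\<lambda>f. \<lambda>i\<in>I. g i (f i)) \<in> measurable (PiM I M) (PiM I M)"
    by (intro measurable_restrict measurable_compose[OF measurable_component_singleton] meas)
  fix A assume A: "\<And>i. i \<in> I \<Longrightarrow> A i \<in> sets (M i)"
  have "(\<lambda>f. \<lambda>i\<in>I. g i (f i)) -` Pi\<^sub>E I A \<inter> space (PiM I M)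
      = Pi\<^sub>E I (\<lambda>i. g i -` A i \<inter> space (M i))"
    by (auto simp: space_PiM PiE_iff)
  then have "emeasure (distr (PiM I M) (PiM I M) (\<lambda>f. \<lambda>i\<in>I. g i (f i))) (Pi\<^sub>E I A)
      = (\<Prod>i\<in>I. emeasure (M i) (g i -` A i \<inter> space (M i)))"
    using A \<open>finite I\<close> T measurable_sets[OF meas A]
    by (simp add: emeasure_distr sets_PiM_I_finite emeasure_PiM)
  also have "\<dots> = (\<Prod>i\<in>I. emeasure (M i) (A i))"
  proof (rule prod.cong[OF refl])
    fix i assume "i \<in> I"
    then have "emeasure (distr (M i) (M i) (g i)) (A i) = emeasure (M i) (g i -` A i \<inter> space (M i))"
      by (intro emeasure_distr meas A)
    then show "emeasure (M i) (g i -` A i \<inter> space (M i)) = emeasure (M i) (A i)"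
      by (simp only: pres[OF \<open>i \<in> I\<close>])
  qed
  finally show "emeasure (distr (PiM I M) (PiM I M) (\<lambda>f. \<lambda>i\<in>I. g i (f i))) (Pi\<^sub>E I A)
      = (\<Prod>i\<in>I. emeasure (M i) (A i))" .
qed simp

lemma (in product_sigma_finite) emeasure_PiM_componentwise:
  assumes "finite I"
    and meas: "\<And>i. i \<in> I \<Longrightarrow> g i \<in> measurable (M i) (M i)"
    and pres: "\<And>i. i \<in> I \<Longrightarrow> distr (M i) (M i) (g i) = M i"
    and S: "S \<in> sets (PiM I M)"
  shows "emeasure (PiM I M) ((\<lambda>f. \<lambda>i\<in>I. g i (f i)) -` S \<inter> space (PiM I M)) = emeasure (PiM I M) S"
proof -
  have T: "(\<lambda>f. \<lambda>i\<in>I. g i (f i)) \<in> measurable (PiM I M) (PiM I M)"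
    by (intro measurable_restrict measurable_compose[OF measurable_component_singleton] meas)
  show ?thesis
    using emeasure_distr[OF T S] by (simp only: distr_PiM_componentwise[OF assms(1-3)])
qed

section \<open>Volume comparison for half balls\<close>

text \<open>Passing from balls to half balls costs a factor 2 in volume but shrinks the enclosing
  radius from \<open>1 + r\<close> to \<open>sqrt (1 + r\<^sup>2)\<close>, which improves the base
  of the exponential bound.\<close>

lemma half_ball_packing:
  fixes e :: "'b \<Rightarrow> 'i \<Rightarrow> real"
  assumes "finite I" "finite B" "0 < r"
    and unit: "\<And>a. a \<in> B \<Longrightarrow> (\<Sum>i\<in>I. (e a i)\<^sup>2) = 1"
    and sep: "\<And>a b. a \<in> B \<Longrightarrow> b \<in> B \<Longrightarrow> a \<noteq> b \<Longrightarrow> 4 * r\<^sup>2 < (\<Sum>i\<in>I. (e a i - e b i)\<^sup>2)"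
  shows "real (card B) * r ^ card I \<le> 2 * sqrt (1 + r\<^sup>2) ^ card I"
proof -
  define P where "P = PiM I (\<lambda>_. lborel :: real measure)"
  define D where "D R = {f. sqrt (\<Sum>i\<in>I. (f i)\<^sup>2) \<le> R} \<inter> space P" for R
  define H where "H a = {f \<in> space P. (\<Sum>i\<in>I. (f i)\<^sup>2) \<le> r\<^sup>2 \<and> (\<Sum>i\<in>I. f i * e a i) \<le> 0}" for a
  define H' where "H' a = {f \<in> space P. (\<Sum>i\<in>I. (f i)\<^sup>2) \<le> r\<^sup>2 \<and> (\<Sum>i\<in>I. f i * e a i) \<ge> 0}" for a
  \<comment> \<open>\<open>K a\<close> is the half ball \<open>H a\<close> moved to the centre
    \<open>e a\<close>, written as a preimage so that translation invariance applies.\<close>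
  define K where "K a = (\<lambda>f. \<lambda>i\<in>I. - e a i + f i) -` H a \<inter> space P" for a
  define v where "v = unit_ball_vol (real (card I))"
  have v: "v > 0" by (simp add: v_def)
  have D: "emeasure P (D R) = ennreal (v * R ^ card I)" if "R > 0" for R
    using emeasure_cball_aux[OF \<open>finite I\<close> that] by (simp add: D_def P_def v_def)
  have [measurable]: "D R \<in> sets P" for R
    unfolding D_def P_def by measurable
  have [measurable]: "H a \<in> sets P" "H' a \<in> sets P" for a
    unfolding H_def H'_def P_def by measurable
  have trans: "emeasure P (K a) = emeasure P (H a)" for a
    unfolding K_def P_def
  proof (rule product_sigma_finite.emeasure_PiM_componentwise[OF _ \<open>finite I\<close>])
    show "product_sigma_finite (\<lambda>_::'i. lborel :: real measure)" by standard
    show "distr lborel lborel ((+) (- e a i)) = lborel" for i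
      using lborel_distr_plus[of "- e a i"] by (simp cong: distr_cong)
    show "H a \<in> sets (PiM I (\<lambda>_. lborel))" using \<open>H a \<in> sets P\<close> by (simp add: P_def)
  qed simp
  have [measurable]: "K a \<in> sets P" for a
    unfolding K_def using \<open>H a \<in> sets P\<close> unfolding P_def by measurable
  \<comment> \<open>\<open>H' a\<close> is the image of \<open>H a\<close> under reflection in the
    origin, so the two have equal volume. Together they cover \<open>D r\<close>, hence each has at
    least half of its volume.\<close>
  have reflect: "(\<lambda>f. \<lambda>i\<in>I. - f i) -` H a \<inter> space P = H' a" for a
    unfolding H_def H'_def P_def by (auto simp: space_PiM sum_negf)
  have eqH: "emeasure P (H' a) = emeasure P (H a)" for a
    unfolding reflect[of a, symmetric] P_def
  proof (rule product_sigma_finite.emeasure_PiM_componentwise[OF _ \<open>finite I\<close>])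
    show "product_sigma_finite (\<lambda>_::'i. lborel :: real measure)" by standard
    show "distr lborel lborel uminus = (lborel :: real measure)"
      using lborel_distr_uminus by (simp cong: distr_cong)
    show "H a \<in> sets (PiM I (\<lambda>_. lborel))" using \<open>H a \<in> sets P\<close> by (simp add: P_def)
  qed simp
  have DH: "D r \<subseteq> H a \<union> H' a" for a
    using \<open>0 < r\<close> by (auto simp: D_def H_def H'_def real_sqrt_le_iff' sum_nonneg)
  have "ennreal (v * r ^ card I) \<le> 2 * emeasure P (H a)" for a
  proof -
    have "ennreal (v * r ^ card I) \<le> emeasure P (H a \<union> H' a)"
      using emeasure_mono[OF DH[of a], of P] D[OF \<open>0 < r\<close>] by simp
    also have "\<dots> \<le> emeasure P (H a) + emeasure P (H' a)"
      by (rule emeasure_subadditive) auto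
    finally show ?thesis by (simp add: eqH mult_2)
  qed
  then have lower: "ennreal (v * r ^ card I) \<le> 2 * emeasure P (K a)" for a
    by (simp add: trans)
  have Kmem: "f \<in> space P \<and> (\<Sum>i\<in>I. (f i - e a i)\<^sup>2) \<le> r\<^sup>2 \<and> (\<Sum>i\<in>I. (f i - e a i) * e a i) \<le> 0"
    if "f \<in> K a" for f a
    using that unfolding K_def H_def by (auto simp: algebra_simps)
  have disj: "disjoint_family_on K B"
    unfolding disjoint_family_on_def
  proof (intro ballI impI, rule ccontr)
    fix a b assume ab: "a \<in> B" "b \<in> B" "a \<noteq> b" and "K a \<inter> K b \<noteq> {}"
    then obtain f where f: "f \<in> K a" "f \<in> K b" by auto
    \<comment> \<open>With \<open>u = f - e a\<close> and \<open>v = f - e b\<close> this is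
      \<open>|u - v|^2 <= 2 |u|^2 + 2 |v|^2\<close>, and both terms on the right are at most
      \<open>2 * r\<^sup>2\<close>.\<close>
    have "(\<Sum>i\<in>I. (e a i - e b i)\<^sup>2) \<le> (\<Sum>i\<in>I. 2 * (f i - e a i)\<^sup>2 + 2 * (f i - e b i)\<^sup>2)"
    proof (rule sum_mono)
      fix i
      have "0 \<le> ((f i - e a i) + (f i - e b i))\<^sup>2" by simp
      then show "(e a i - e b i)\<^sup>2 \<le> 2 * (f i - e a i)\<^sup>2 + 2 * (f i - e b i)\<^sup>2"
        by (simp add: power2_eq_square algebra_simps)
    qed
    also have "\<dots> = 2 * (\<Sum>i\<in>I. (f i - e a i)\<^sup>2) + 2 * (\<Sum>i\<in>I. (f i - e b i)\<^sup>2)"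
      by (simp add: sum.distrib sum_distrib_left)
    also have "\<dots> \<le> 4 * r\<^sup>2" using Kmem[OF f(1)] Kmem[OF f(2)] by linarith
    finally show False using sep[OF ab] by linarith
  qed
  have sub: "(\<Union>a\<in>B. K a) \<subseteq> D (sqrt (1 + r\<^sup>2))"
  proof
    fix f assume "f \<in> (\<Union>a\<in>B. K a)"
    then obtain a where a: "a \<in> B" "f \<in> K a" by auto
    \<comment> \<open>Expansion of the squared length of \<open>(f - e a) + e a\<close>. On the half
      that faces the origin the cross term is nonpositive.\<close>
    have "(\<Sum>i\<in>I. (f i)\<^sup>2) = (\<Sum>i\<in>I. (f i - e a i)\<^sup>2 + 2 * ((f i - e a i) * e a i) + (e a i)\<^sup>2)"
      by (rule sum.cong) (auto simp: power2_eq_square algebra_simps)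
    also have "\<dots> = (\<Sum>i\<in>I. (f i - e a i)\<^sup>2) + 2 * (\<Sum>i\<in>I. (f i - e a i) * e a i) + 1"
      using unit[OF a(1)] by (simp add: sum.distrib sum_distrib_left)
    also have "\<dots> \<le> 1 + r\<^sup>2" using Kmem[OF a(2)] by linarith
    finally show "f \<in> D (sqrt (1 + r\<^sup>2))" using Kmem[OF a(2)] by (simp add: D_def)
  qed
  have "ennreal (real (card B) * (v * r ^ card I)) = (\<Sum>a\<in>B. ennreal (v * r ^ card I))"
    using v \<open>0 < r\<close> by (simp add: ennreal_mult ennreal_of_nat_eq_real_of_nat)
  also have "\<dots> \<le> (\<Sum>a\<in>B. 2 * emeasure P (K a))"
    by (rule sum_mono) (rule lower)
  also have "\<dots> = 2 * emeasure P (\<Union>a\<in>B. K a)"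
    using \<open>finite B\<close> disj by (subst sum_emeasure[symmetric]) (auto simp: sum_distrib_left)
  also have "\<dots> \<le> 2 * emeasure P (D (sqrt (1 + r\<^sup>2)))"
    by (intro mult_left_mono emeasure_mono sub) auto
  also have "\<dots> = ennreal (2 * (v * sqrt (1 + r\<^sup>2) ^ card I))"
  proof -
    have "sqrt (1 + r\<^sup>2) > 0" by (simp add: add_pos_nonneg)
    then show ?thesis using v by (simp add: D ennreal_mult)
  qed
  finally have "real (card B) * (v * r ^ card I) \<le> 2 * (v * sqrt (1 + r\<^sup>2) ^ card I)"
    using v by (subst (asm) ennreal_le_iff) auto
  then have "v * (real (card B) * r ^ card I) \<le> v * (2 * sqrt (1 + r\<^sup>2) ^ card I)"
    by (simp add: mult_ac)
  then show ?thesis using v by (simp only: mult_le_cancel_left_pos)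
qed

text \<open>The radius is chosen so that \<open>1 + 1 / r\<^sup>2 = 1 / \<delta>\<^sup>2\<close>.\<close>

lemma unit_vectors_packing:
  fixes e :: "'b \<Rightarrow> 'i \<Rightarrow> real"
  assumes "finite I" "finite B" and \<delta>: "0 < \<delta>" "2 * \<delta> < 1"
    and unit: "\<And>a. a \<in> B \<Longrightarrow> (\<Sum>i\<in>I. (e a i)\<^sup>2) = 1"
    and sep: "\<And>a b. a \<in> B \<Longrightarrow> b \<in> B \<Longrightarrow> a \<noteq> b \<Longrightarrow> (\<Sum>i\<in>I. e a i * e b i) \<le> sqrt (1 - (2 * \<delta>)\<^sup>2)"
  shows "real (card B) \<le> 2 * inverse \<delta> ^ card I"
proof -
  define y where "y = \<delta>\<^sup>2"
  define r where "r = sqrt (y / (1 - y))"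
  have "\<delta> * \<delta> < (1/2) * (1/2)" using \<delta> by (intro mult_strict_mono) auto
  then have y: "0 < y" "4 * y < 1" using \<delta> by (auto simp: y_def power2_eq_square)
  have r: "0 < r" "r\<^sup>2 = y / (1 - y)" using y by (auto simp: r_def)
  have "sqrt (1 - (2 * \<delta>)\<^sup>2) < 1 - 2 * r\<^sup>2"
  proof (rule real_less_lsqrt)
    have e: "1 - 2 * r\<^sup>2 = (1 - 3 * y) / (1 - y)" using y by (simp add: r field_simps)
    show "0 \<le> 1 - 2 * r\<^sup>2" unfolding e using y by simp
    \<comment> \<open>The squared inequality with denominators cleared. The two sides differ by
      exactly \<open>4 * y ^ 3\<close>, which yields the strict separation that makes the balls
      disjoint.\<close>
    have "(1 - 4 * y) * (1 - y)\<^sup>2 < (1 - 3 * y)\<^sup>2"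
    proof -
      have "(1 - 3 * y)\<^sup>2 - (1 - 4 * y) * (1 - y)\<^sup>2 = 4 * y ^ 3"
        by (simp add: power2_eq_square power3_eq_cube algebra_simps)
      moreover have "y ^ 3 > 0" using y by simp
      ultimately show ?thesis by linarith
    qed
    then show "1 - (2 * \<delta>)\<^sup>2 < (1 - 2 * r\<^sup>2)\<^sup>2"
      unfolding e using y by (simp add: power_divide power_mult_distrib y_def[symmetric] pos_less_divide_eq)
  qed
  moreover have "(\<Sum>i\<in>I. (e a i - e b i)\<^sup>2) = 2 - 2 * (\<Sum>i\<in>I. e a i * e b i)" if "a \<in> B" "b \<in> B" for a b
  proof -
    have "(\<Sum>i\<in>I. (e a i - e b i)\<^sup>2) = (\<Sum>i\<in>I. (e a i)\<^sup>2 + (e b i)\<^sup>2 - 2 * (e a i * e b i))"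
      by (rule sum.cong) (auto simp: power2_eq_square algebra_simps)
    then show ?thesis using unit that by (simp add: sum.distrib sum_subtractf sum_distrib_left)
  qed
  ultimately have "4 * r\<^sup>2 < (\<Sum>i\<in>I. (e a i - e b i)\<^sup>2)" if "a \<in> B" "b \<in> B" "a \<noteq> b" for a b
    using sep[OF that] that(1,2) by auto
  then have *: "real (card B) * r ^ card I \<le> 2 * sqrt (1 + r\<^sup>2) ^ card I"
    by (intro half_ball_packing[OF assms(1,2) r(1) unit])
  have "sqrt (1 + r\<^sup>2) = r * inverse \<delta>"
  proof (rule real_sqrt_unique)
    have "(r * inverse \<delta>)\<^sup>2 = y / (1 - y) * inverse y"
      by (simp only: power_mult_distrib r(2) power_inverse y_def)
    also have "\<dots> = 1 + r\<^sup>2"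
      unfolding r(2) using y by (simp add: divide_simps)
    finally show "(r * inverse \<delta>)\<^sup>2 = 1 + r\<^sup>2" .
  qed (use r \<delta> in auto)
  then have "r ^ card I * real (card B) \<le> r ^ card I * (2 * inverse \<delta> ^ card I)"
    using * by (simp add: power_mult_distrib mult_ac)
  then show ?thesis using r(1) by (simp only: mult_le_cancel_left_pos zero_less_power)
qed

unbundle no inner_syntax
unbundle no vec_syntax

section \<open>Orthonormal bases of spans\<close>

text \<open>The square matrix with rows \<open>a j\<close>, padded by zero rows, is singular because
  \<open>m < k\<close>; a nonzero kernel vector is orthogonal to every row and can be
  normalised.\<close>

lemma exists_unit_orthogonal:
  fixes a :: "nat \<Rightarrow> real vec"
  assumes "m < k" and a: "\<And>j. j < m \<Longrightarrow> a j \<in> carrier_vec k"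
  shows "\<exists>v\<in>carrier_vec k. v \<bullet> v = 1 \<and> (\<forall>j<m. a j \<bullet> v = 0)"
proof -
  define A where "A = mat\<^sub>r k k (\<lambda>i. if i = m then 0\<^sub>v k else if i < m then a i else 0\<^sub>v k)"
  have A: "A \<in> carrier_mat k k" by (simp add: A_def)
  have "det A = 0"
    unfolding A_def by (rule det_row_0[OF \<open>m < k\<close>]) (use a in auto)
  then obtain v where v: "v \<in> carrier_vec k" "v \<noteq> 0\<^sub>v k" "A *\<^sub>v v = 0\<^sub>v k"
    using det_0_iff_vec_prod_zero_field[OF A] by blast
  have "a j \<bullet> v = 0" if "j < m" for j
  proof -
    have "(A *\<^sub>v v) $ j = row A j \<bullet> v" using that \<open>m < k\<close> A by simp
    also have "row A j = a j" using that \<open>m < k\<close> a[OF that] by (simp add: A_def)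
    finally show ?thesis using v(3) that \<open>m < k\<close> by simp
  qed
  moreover have pos: "v \<bullet> v > 0"
    using v(1,2) conjugate_square_greater_0_vec[of v k] by simp
  ultimately show ?thesis
    using v(1) a
    by (intro bexI[of _ "(1 / sqrt (v \<bullet> v)) \<cdot>\<^sub>v v"]) (auto simp: field_simps)
qed

text \<open>Vectors are added one at a time: as long as fewer than \<open>d\<close> are found, they
  and the \<open>a j\<close> together number less than \<open>k\<close>, so one more unit vector
  orthogonal to all of them exists. With \<open>m + d = k\<close> and orthonormal \<open>a\<close>
  this gives an orthonormal basis of the complement.\<close>

lemma exists_orthonormal_orthogonal:
  fixes a :: "nat \<Rightarrow> real vec"
  assumes "m + d \<le> k" and a: "\<And>j. j < m \<Longrightarrow> a j \<in> carrier_vec k"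
  shows "\<exists>b. (\<forall>i<d. b i \<in> carrier_vec k) \<and> (\<forall>i<d. \<forall>j<d. b i \<bullet> b j = (if i = j then 1 else 0))
    \<and> (\<forall>j<m. \<forall>i<d. a j \<bullet> b i = 0)"
  using \<open>m + d \<le> k\<close>
proof (induction d)
  case 0
  then show ?case by simp
next
  case (Suc d)
  then obtain b where b: "\<forall>i<d. b i \<in> carrier_vec k"
    "\<forall>i<d. \<forall>j<d. b i \<bullet> b j = (if i = j then 1 else 0)" "\<forall>j<m. \<forall>i<d. a j \<bullet> b i = 0" by auto
  have "\<exists>v\<in>carrier_vec k. v \<bullet> v = 1 \<and> (\<forall>j<m+d. (if j < m then a j else b (j - m)) \<bullet> v = 0)"
    using Suc.prems a b(1) by (intro exists_unit_orthogonal) auto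
  then obtain v where v: "v \<in> carrier_vec k" "v \<bullet> v = 1"
    and z: "\<And>j. j < m + d \<Longrightarrow> (if j < m then a j else b (j - m)) \<bullet> v = 0" by auto
  have av: "a j \<bullet> v = 0" if "j < m" for j using z[of j] that by simp
  have bv: "b j \<bullet> v = 0" if "j < d" for j using z[of "m + j"] that by simp
  have vb: "v \<bullet> b j = 0" if "j < d" for j
    using bv[OF that] comm_scalar_prod[OF v(1), of "b j"] b(1) that by simp
  show ?case
    by (rule exI[of _ "b(d := v)"]) (use b v av bv vb in \<open>auto simp: less_Suc_eq\<close>)
qed

text \<open>For the square matrix \<open>Q\<close> with rows \<open>b i\<close>,
  \<open>Q * Q\<^sup>T = 1\<close> forces \<open>Q\<^sup>T * Q = 1\<close>, so \<open>Q\<close>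
  preserves scalar products.\<close>

lemma parseval_orthonormal:
  fixes b :: "nat \<Rightarrow> real vec"
  assumes b: "\<And>i. i < k \<Longrightarrow> b i \<in> carrier_vec k"
    and orth: "\<And>i j. i < k \<Longrightarrow> j < k \<Longrightarrow> b i \<bullet> b j = (if i = j then 1 else 0)"
    and y: "y \<in> carrier_vec k" and z: "z \<in> carrier_vec k"
  shows "y \<bullet> z = (\<Sum>i<k. (b i \<bullet> y) * (b i \<bullet> z))"
proof -
  define Q where "Q = mat\<^sub>r k k b"
  have Q: "Q \<in> carrier_mat k k" by (simp add: Q_def)
  have row: "row Q i = b i" if "i < k" for i using that b by (simp add: Q_def)
  have "Q * Q\<^sup>T = 1\<^sub>m k"
    by (rule eq_matI) (use Q row orth in auto)
  then have "Q\<^sup>T * Q = 1\<^sub>m k"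
    using mat_mult_left_right_inverse[OF Q, of "Q\<^sup>T"] Q by simp
  then have "z = Q\<^sup>T *\<^sub>v (Q *\<^sub>v z)"
    using Q z assoc_mult_mat_vec[of "Q\<^sup>T" k k Q k z] by simp
  then have "y \<bullet> z = y \<bullet> (Q\<^sup>T *\<^sub>v (Q *\<^sub>v z))" by simp
  also have "\<dots> = (Q *\<^sub>v y) \<bullet> (Q *\<^sub>v z)"
    using Q y z transpose_vec_mult_scalar[of Q k k y "Q *\<^sub>v z"]
    by (metis mult_mat_vec_carrier comm_scalar_prod transpose_carrier_mat)
  also have "\<dots> = (\<Sum>i<k. (b i \<bullet> y) * (b i \<bullet> z))"
    using Q row by (auto simp: scalar_prod_def[of "Q *\<^sub>v y"] atLeast0LessThan intro!: sum.cong)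
  finally show ?thesis .
qed

section \<open>Gram-Schmidt orthonormalisation\<close>

locale real_vec_space = vec_space "TYPE(real)" n for n :: nat
begin

lemma zero_in_span: "0\<^sub>v n \<in> span S"
  by (intro in_spanI[of _ "\<lambda>_. 0" "{}"]) (auto simp: lincomb_def)

text \<open>Coefficients belong to indices here, whereas in \<open>lincomb\<close> they belong to
  the vectors of a set; this suits expansions in an indexed orthonormal family.\<close>

primrec lcomb :: "(nat \<Rightarrow> real vec) \<Rightarrow> (nat \<Rightarrow> real) \<Rightarrow> nat \<Rightarrow> real vec" where
  "lcomb w c 0 = 0\<^sub>v n"
| "lcomb w c (Suc m) = lcomb w c m + c m \<cdot>\<^sub>v w m"

lemma lcomb_in_span:
  assumes "S \<subseteq> carrier_vec n" "\<And>j. j < m \<Longrightarrow> w j \<in> span S"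
  shows "lcomb w c m \<in> span S"
  using assms(2)
proof (induction m)
  case 0
  show ?case by (simp add: zero_in_span)
next
  case (Suc m)
  then show ?case
    using span_add1[OF assms(1) _ smult_in_span[OF assms(1), of "w m" "c m"]] by simp
qed

lemma lcomb_carrier:
  assumes "\<And>j. j < m \<Longrightarrow> w j \<in> carrier_vec n"
  shows "lcomb w c m \<in> carrier_vec n"
  using assms by (induction m) auto

lemma scalar_prod_lcomb:
  assumes "\<And>j. j < m \<Longrightarrow> w j \<in> carrier_vec n" and z: "z \<in> carrier_vec n"
  shows "z \<bullet> lcomb w c m = (\<Sum>j<m. c j * (z \<bullet> w j))"
  using assms(1)
proof (induction m)
  case (Suc m)
  then show ?case
    using z lcomb_carrier[of m w c] by (simp add: scalar_prod_add_distrib[of _ n])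
qed (use z in simp)

text \<open>Completeness is stated as the absence of a nonzero vector of \<open>U\<close> orthogonal
  to all \<open>w j\<close>. For a subspace \<open>U\<close> this is the same as being spanned by
  the \<open>w j\<close>, and it avoids dimension counting.\<close>

definition orthonormal_basis :: "nat \<Rightarrow> (nat \<Rightarrow> real vec) \<Rightarrow> real vec set \<Rightarrow> bool" where
  "orthonormal_basis m w U \<longleftrightarrow> (\<forall>j<m. w j \<in> U)
     \<and> (\<forall>i<m. \<forall>j<m. w i \<bullet> w j = (if i = j then 1 else 0))
     \<and> (\<forall>y\<in>U. (\<forall>j<m. w j \<bullet> y = 0) \<longrightarrow> y = 0\<^sub>v n)"

lemma minus_in_span:
  assumes "S \<subseteq> carrier_vec n" "x \<in> span S" "y \<in> span S"
  shows "x - y \<in> span S"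
proof -
  have "x + (-1) \<cdot>\<^sub>v y \<in> span S"
    using span_add1[OF assms(1,2) smult_in_span[OF assms(1,3), of "-1"]] by simp
  moreover have "x + (-1) \<cdot>\<^sub>v y = x - y"
    using span_closed[OF assms(1,2)] span_closed[OF assms(1,3)] by (intro eq_vecI) auto
  ultimately show ?thesis by simp
qed

lemma span_insert:
  assumes S: "S \<subseteq> carrier_vec n" and x: "x \<in> carrier_vec n"
  shows "span (insert x S) = {u + c \<cdot>\<^sub>v x | u c. u \<in> span S}"
proof (intro equalityI subsetI)
  have S': "insert x S \<subseteq> carrier_vec n" using S x by simp
  fix y assume "y \<in> {u + c \<cdot>\<^sub>v x | u c. u \<in> span S}"
  then obtain u c where y: "y = u + c \<cdot>\<^sub>v x" and u: "u \<in> span S" by auto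
  have "u \<in> span (insert x S)" using u span_is_monotone[of S "insert x S"] by auto
  moreover have "x \<in> span (insert x S)" using span_mem[OF S'] by simp
  ultimately show "y \<in> span (insert x S)"
    unfolding y using span_add1[OF S' _ smult_in_span[OF S']] by simp
next
  fix y assume "y \<in> span (insert x S)"
  then obtain a A where y: "y = lincomb a A" "finite A" "A \<subseteq> insert x S" using in_spanE by blast
  show "y \<in> {u + c \<cdot>\<^sub>v x | u c. u \<in> span S}"
  proof (cases "x \<in> A")
    case False
    then have "y \<in> span S" using y by (intro in_spanI) auto
    then have "y = y + 0 \<cdot>\<^sub>v x" using span_closed[OF S] x by (auto intro!: eq_vecI)
    with \<open>y \<in> span S\<close> show ?thesis by blast
  next
    case True
    define B where "B = A - {x}"
    have B: "A = insert x B" "x \<notin> B" "finite B" "B \<subseteq> S" "B \<subseteq> carrier_vec n"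
      using True y S by (auto simp: B_def)
    have "lincomb a A = a x \<cdot>\<^sub>v x + lincomb a B"
      unfolding B(1) using B x by (subst lincomb_insert2) auto
    also have "\<dots> = lincomb a B + a x \<cdot>\<^sub>v x"
      using x lincomb_closed[OF B(5)] by (intro comm_add_vec) auto
    finally have "y = lincomb a B + a x \<cdot>\<^sub>v x" using y by simp
    moreover have "lincomb a B \<in> span S" using B by (intro in_spanI) auto
    ultimately show ?thesis by blast
  qed
qed

text \<open>One Gram-Schmidt step: \<open>e\<close> is the normalised residual of \<open>x\<close>
  after subtracting its projection \<open>q\<close> onto \<open>span S\<close>. The residual is
  nonzero because \<open>x\<close> lies outside \<open>span S\<close>.\<close>

lemma orthonormal_basis_insert:
  assumes S: "S \<subseteq> carrier_vec n" and w: "orthonormal_basis m w (span S)"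
    and x: "x \<in> carrier_vec n" "x \<notin> span S"
  obtains e where "e \<in> carrier_vec n" "e \<bullet> e = 1" "\<And>u. u \<in> span S \<Longrightarrow> u \<bullet> e = 0"
    "span (insert x S) = {u + c \<cdot>\<^sub>v e | u c. u \<in> span S}"
proof -
  have wS: "w j \<in> span S" if "j < m" for j using w that by (simp add: orthonormal_basis_def)
  have wc: "w j \<in> carrier_vec n" if "j < m" for j using span_closed[OF S wS[OF that]] .
  have proj: "w i \<bullet> lcomb w (\<lambda>j. w j \<bullet> z) m = w i \<bullet> z" if "i < m" for i z
  proof -
    have "w i \<bullet> lcomb w (\<lambda>j. w j \<bullet> z) m = (\<Sum>j<m. (w j \<bullet> z) * (w i \<bullet> w j))"
      using wc that by (intro scalar_prod_lcomb)
    also have "\<dots> = (\<Sum>j<m. if i = j then w j \<bullet> z else 0)"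
      using w that by (intro sum.cong) (auto simp: orthonormal_basis_def)
    also have "\<dots> = w i \<bullet> z" using that by simp
    finally show ?thesis .
  qed
  define q where "q = lcomb w (\<lambda>j. w j \<bullet> x) m"
  define r where "r = x - q"
  have qS: "q \<in> span S" unfolding q_def by (rule lcomb_in_span[OF S wS])
  have q: "q \<in> carrier_vec n" using span_closed[OF S qS] .
  have r: "r \<in> carrier_vec n" using x q by (simp add: r_def)
  have wr: "w i \<bullet> r = 0" if "i < m" for i
    using wc[OF that] x q proj[OF that, of x] by (simp add: r_def q_def scalar_prod_minus_distrib[of _ n])
  \<comment> \<open>Orthogonality to the \<open>w j\<close> extends to the whole span:
    \<open>u - q'\<close> is orthogonal to all \<open>w j\<close>, so completeness gives
    \<open>u = q'\<close>, a combination of the \<open>w j\<close>.\<close>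
  have ur: "u \<bullet> r = 0" if u: "u \<in> span S" for u
  proof -
    define q' where "q' = lcomb w (\<lambda>j. w j \<bullet> u) m"
    have uc: "u \<in> carrier_vec n" using span_closed[OF S u] .
    have q'S: "q' \<in> span S" unfolding q'_def by (rule lcomb_in_span[OF S wS])
    have q'c: "q' \<in> carrier_vec n" using span_closed[OF S q'S] .
    have "w i \<bullet> (u - q') = 0" if "i < m" for i
      using wc[OF that] uc q'c proj[OF that, of u] by (simp add: q'_def scalar_prod_minus_distrib[of _ n])
    then have "u - q' = 0\<^sub>v n"
      using w minus_in_span[OF S u q'S] by (simp add: orthonormal_basis_def)
    then have "u = q'" using uc q'c by (auto simp: vec_eq_iff)
    moreover have "r \<bullet> q' = (\<Sum>j<m. (w j \<bullet> u) * (r \<bullet> w j))"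
      unfolding q'_def using wc r by (intro scalar_prod_lcomb)
    moreover have "r \<bullet> w j = 0" if "j < m" for j
      using wr[OF that] comm_scalar_prod[OF r wc[OF that]] by simp
    ultimately show ?thesis using comm_scalar_prod[OF uc r] by simp
  qed
  have "r \<noteq> 0\<^sub>v n"
  proof
    assume "r = 0\<^sub>v n"
    then have "x = q" using x q by (auto simp: r_def vec_eq_iff)
    then show False using qS x by simp
  qed
  then have pos: "r \<bullet> r > 0" using r conjugate_square_greater_0_vec[of r n] by simp
  define t where "t = 1 / sqrt (r \<bullet> r)"
  have t: "t > 0" "t * t * (r \<bullet> r) = 1" using pos by (auto simp: t_def field_simps)
  define e where "e = t \<cdot>\<^sub>v r"
  have e: "e \<in> carrier_vec n" using r by (simp add: e_def)
  show thesis
  proof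
    show "e \<in> carrier_vec n" by (rule e)
    show "e \<bullet> e = 1" using r t by (simp add: e_def)
    show "u \<bullet> e = 0" if "u \<in> span S" for u
      using ur[OF that] r span_closed[OF S that] by (simp add: e_def)
    show "span (insert x S) = {u + c \<cdot>\<^sub>v e | u c. u \<in> span S}"
      unfolding span_insert[OF S x(1)]
    proof (intro equalityI subsetI)
      fix y assume "y \<in> {u + c \<cdot>\<^sub>v x | u c. u \<in> span S}"
      then obtain u c where u: "u \<in> span S" and y: "y = u + c \<cdot>\<^sub>v x" by auto
      \<comment> \<open>Change of generator by \<open>x = q + (1 / t) e\<close>; the converse
        inclusion uses \<open>e = t x - t q\<close>.\<close>
      have "y = (u + c \<cdot>\<^sub>v q) + (c / t) \<cdot>\<^sub>v e"
        unfolding y e_def r_def using span_closed[OF S u] x q t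
        by (intro eq_vecI) (auto simp: algebra_simps)
      moreover have "u + c \<cdot>\<^sub>v q \<in> span S"
        using span_add1[OF S u smult_in_span[OF S qS]] by simp
      ultimately show "y \<in> {u + c \<cdot>\<^sub>v e | u c. u \<in> span S}" by blast
    next
      fix y assume "y \<in> {u + c \<cdot>\<^sub>v e | u c. u \<in> span S}"
      then obtain u c where u: "u \<in> span S" and y: "y = u + c \<cdot>\<^sub>v e" by auto
      have "y = (u + (- c * t) \<cdot>\<^sub>v q) + (c * t) \<cdot>\<^sub>v x"
        unfolding y e_def r_def using span_closed[OF S u] x q
        by (intro eq_vecI) (auto simp: algebra_simps)
      moreover have "u + (- c * t) \<cdot>\<^sub>v q \<in> span S"
        using span_add1[OF S u smult_in_span[OF S qS]] by simp
      ultimately show "y \<in> {u + c \<cdot>\<^sub>v x | u c. u \<in> span S}" by blast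
    qed
  qed
qed

lemma gram_schmidt_orthonormal_basis:
  assumes x: "\<And>j. j < m \<Longrightarrow> x j \<in> carrier_vec n"
    and indep: "\<And>j. j < m \<Longrightarrow> x j \<notin> span (x ` {..<j})"
  shows "\<exists>w. orthonormal_basis m w (span (x ` {..<m}))"
  using assms
proof (induction m)
  case 0
  then show ?case by (simp add: orthonormal_basis_def span_empty)
next
  case (Suc m)
  define S where "S = x ` {..<m}"
  have S: "S \<subseteq> carrier_vec n" using Suc.prems(1) by (auto simp: S_def)
  obtain w where w: "orthonormal_basis m w (span S)" unfolding S_def using Suc by auto
  have wS: "w j \<in> span S" if "j < m" for j using w that by (simp add: orthonormal_basis_def)
  obtain e where e: "e \<in> carrier_vec n" "e \<bullet> e = 1" "\<And>u. u \<in> span S \<Longrightarrow> u \<bullet> e = 0"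
    "span (insert (x m) S) = {u + c \<cdot>\<^sub>v e | u c. u \<in> span S}"
    using orthonormal_basis_insert[OF S w, of "x m"] Suc.prems by (auto simp: S_def)
  have eq: "x ` {..<Suc m} = insert (x m) S" by (auto simp: S_def lessThan_Suc)
  have sub: "u \<in> span (insert (x m) S)" if "u \<in> span S" for u
    using that span_is_monotone[of S "insert (x m) S"] by auto
  have "0\<^sub>v n + 1 \<cdot>\<^sub>v e \<in> {u + c \<cdot>\<^sub>v e | u c. u \<in> span S}" using zero_in_span by blast
  then have eS: "e \<in> span (insert (x m) S)" unfolding e(4) using e(1) by simp
  have eu: "e \<bullet> u = 0" if "u \<in> span S" for u
    using e(3)[OF that] comm_scalar_prod[OF e(1) span_closed[OF S that]] by simp
  have complete: "y = 0\<^sub>v n"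
    \<comment> \<open>The coefficient of \<open>e\<close> in \<open>y\<close> is
      \<open>e \<bullet> y\<close>, which vanishes; so \<open>y\<close> lies in
      \<open>span S\<close>, where completeness of \<open>w\<close> applies.\<close>
    if "y \<in> span (insert (x m) S)" and y0: "\<And>j. j < Suc m \<Longrightarrow> (w(m := e)) j \<bullet> y = 0" for y
  proof -
    obtain u c where u: "u \<in> span S" and y: "y = u + c \<cdot>\<^sub>v e" using \<open>y \<in> _\<close> unfolding e(4) by auto
    have uc: "u \<in> carrier_vec n" using span_closed[OF S u] .
    have "e \<bullet> y = c" unfolding y using e(1,2) uc eu[OF u] by (simp add: scalar_prod_add_distrib[of _ n])
    then have "c = 0" using y0[of m] by simp
    then have "y = u" unfolding y using uc e(1) by (auto simp: vec_eq_iff)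
    moreover have "w j \<bullet> y = 0" if "j < m" for j using y0[of j] that by simp
    ultimately show ?thesis using u w by (simp add: orthonormal_basis_def)
  qed
  have "orthonormal_basis (Suc m) (w(m := e)) (span (insert (x m) S))"
    unfolding orthonormal_basis_def
  proof (intro conjI allI impI ballI)
    fix y assume "y \<in> span (insert (x m) S)" "\<forall>j<Suc m. (w(m := e)) j \<bullet> y = 0"
    then show "y = 0\<^sub>v n" using complete by blast
  qed (use w wS e(2,3) eu eS sub in \<open>auto simp: orthonormal_basis_def less_Suc_eq\<close>)
  then show ?case unfolding eq by blast
qed

text \<open>In the coordinates given by \<open>w\<close>, orthogonality to the \<open>v j\<close> is
  a system of \<open>i < m\<close> linear equations in \<open>m\<close> unknowns. The
  \<open>v j\<close> may lie outside the span, since only their scalar products with the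
  \<open>w l\<close> enter.\<close>

lemma orthonormal_basis_exists_orthogonal:
  assumes S: "S \<subseteq> carrier_vec n" and w: "orthonormal_basis m w (span S)"
    and "i < m" and v: "\<And>j. j < i \<Longrightarrow> v j \<in> carrier_vec n"
  shows "\<exists>y\<in>span S. y \<bullet> y = 1 \<and> (\<forall>j<i. y \<bullet> v j = 0)"
proof -
  have wS: "w j \<in> span S" if "j < m" for j using w that by (simp add: orthonormal_basis_def)
  have wc: "w j \<in> carrier_vec n" if "j < m" for j using span_closed[OF S wS[OF that]] .
  obtain c where c: "c \<in> carrier_vec m" "c \<bullet> c = 1"
    "\<And>j. j < i \<Longrightarrow> vec m (\<lambda>l. v j \<bullet> w l) \<bullet> c = 0"
    using exists_unit_orthogonal[OF \<open>i < m\<close>, of "\<lambda>j. vec m (\<lambda>l. v j \<bullet> w l)"] by auto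
  define y where "y = lcomb w (\<lambda>l. c $ l) m"
  have yS: "y \<in> span S" unfolding y_def by (rule lcomb_in_span[OF S wS])
  have yc: "y \<in> carrier_vec n" using span_closed[OF S yS] .
  have yprod: "z \<bullet> y = (\<Sum>l<m. c $ l * (z \<bullet> w l))" if "z \<in> carrier_vec n" for z
    unfolding y_def using wc that by (intro scalar_prod_lcomb)
  have wy: "y \<bullet> w l = c $ l" if "l < m" for l
  proof -
    have "w l \<bullet> y = (\<Sum>l'<m. if l = l' then c $ l' else 0)"
      unfolding yprod[OF wc[OF that]]
      using w that by (intro sum.cong) (auto simp: orthonormal_basis_def)
    then show ?thesis using that comm_scalar_prod[OF yc wc[OF that]] by simp
  qed
  have "y \<bullet> y = (\<Sum>l<m. c $ l * c $ l)" unfolding yprod[OF yc] using wy by simp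
  then have "y \<bullet> y = 1" using c(1,2) by (simp add: scalar_prod_def atLeast0LessThan)
  moreover have "y \<bullet> v j = 0" if "j < i" for j
  proof -
    have "v j \<bullet> y = vec m (\<lambda>l. v j \<bullet> w l) \<bullet> c"
      unfolding yprod[OF v[OF that]] using c(1)
      by (auto simp: scalar_prod_def[of _ c] atLeast0LessThan mult.commute intro!: sum.cong)
    then show ?thesis using c(3)[OF that] comm_scalar_prod[OF yc v[OF that]] by simp
  qed
  ultimately show ?thesis using yS by blast
qed

end

section \<open>Principal angles of subspaces meeting in codimension one\<close>

lemma abs_scalar_prod_le_1:
  fixes a b :: "real vec"
  assumes "a \<in> carrier_vec n" "b \<in> carrier_vec n" "a \<bullet> a = 1" "b \<bullet> b = 1"
  shows "\<bar>a \<bullet> b\<bar> \<le> 1"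
proof -
  define c where "c = a \<bullet> b"
  have ba: "b \<bullet> a = c" using comm_scalar_prod[OF assms(2,1)] by (simp add: c_def)
  have "(a - c \<cdot>\<^sub>v b) \<bullet> (a - c \<cdot>\<^sub>v b) \<ge> 0" by (simp add: scalar_prod_def sum_nonneg)
  also have "(a - c \<cdot>\<^sub>v b) \<bullet> (a - c \<cdot>\<^sub>v b) = 1 - c * c"
    using assms ba
    by (simp add: minus_scalar_prod_distrib[of _ n] scalar_prod_minus_distrib[of _ n] c_def[symmetric])
  finally have "(a \<bullet> b)\<^sup>2 \<le> 1" by (simp add: c_def power2_eq_square)
  then show ?thesis by (simp add: abs_square_le_1)
qed

lemma unit_vectors_eqI:
  fixes a b :: "real vec"
  assumes ab: "a \<in> carrier_vec n" "b \<in> carrier_vec n" "a \<bullet> a = 1" "b \<bullet> b = 1" and "a \<bullet> b \<ge> 1"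
  shows "a = b"
proof -
  have "(a - b) \<bullet> (a - b) = 2 - 2 * (a \<bullet> b)"
    using ab comm_scalar_prod[OF ab(1,2)]
    by (simp add: minus_scalar_prod_distrib[of _ n] scalar_prod_minus_distrib[of _ n])
  moreover have "(a - b) \<bullet> (a - b) \<ge> 0"
    by (simp add: scalar_prod_def sum_nonneg)
  ultimately have "(a - b) \<bullet> (a - b) = 0" using \<open>a \<bullet> b \<ge> 1\<close> by simp
  then have "a - b = 0\<^sub>v n" using conjugate_square_eq_0_vec[of "a - b" n] ab by simp
  then show ?thesis using ab by (auto simp: vec_eq_iff)
qed

lemma l2_norm_vec_eq_1_iff: "l2_norm_vec a = 1 \<longleftrightarrow> a \<bullet> a = 1"
  by (simp add: l2_norm_vec_def)

lemma sin_arccos_le: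
  assumes "\<bar>c\<bar> \<le> t" "t \<le> 1"
  shows "sin (arccos t) \<le> sqrt (1 - c\<^sup>2)"
proof -
  have "c\<^sup>2 \<le> t\<^sup>2" using assms(1) by (intro abs_le_square_iff[THEN iffD1]) simp
  then show ?thesis using assms by (simp add: sin_arccos)
qed

section \<open>Two extensions of a common span by one line each\<close>

context real_vec_space
begin

lemma mem_span_add_line:
  assumes "S \<subseteq> carrier_vec n" "e \<in> carrier_vec n" "a \<in> span S"
  shows "a \<in> {u + c \<cdot>\<^sub>v e | u c. u \<in> span S}"
  using assms span_closed[OF assms(1,3)] by (intro CollectI exI[of _ a] exI[of _ 0]) (auto simp: vec_eq_iff)

lemma smult_mem_span_add_line:
  assumes "e \<in> carrier_vec n"
  shows "c \<cdot>\<^sub>v e \<in> {u + d \<cdot>\<^sub>v e | u d. u \<in> span S}"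
  using assms zero_in_span by (intro CollectI exI[of _ "0\<^sub>v n"] exI[of _ c]) simp

text \<open>Whatever the choice of principal vectors, the first \<open>m\<close> pairs coincide and
  lie in \<open>span S\<close>, with cosine 1. At the last step \<open>e\<close> and
  \<open>f\<close>, up to sign, are still admissible, so the last cosine is at least
  \<open>\<bar>e \<bullet> f\<bar>\<close>. The upper bound 1 keeps the cosines in the domain where
  \<open>arccos\<close> behaves.\<close>

lemma principal_vectors_adjacent:
  assumes S: "S \<subseteq> carrier_vec n" and w: "orthonormal_basis m w (span S)"
    and e: "e \<in> carrier_vec n" "e \<bullet> e = 1" "\<And>u. u \<in> span S \<Longrightarrow> u \<bullet> e = 0"
    and f: "f \<in> carrier_vec n" "f \<bullet> f = 1" "\<And>u. u \<in> span S \<Longrightarrow> u \<bullet> f = 0"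
    and E: "E = {u + c \<cdot>\<^sub>v e | u c. u \<in> span S}" and F: "F = {u + c \<cdot>\<^sub>v f | u c. u \<in> span S}"
    and "E \<noteq> F" and uv: "principal_vectors (Suc m) E F u v" and i: "i < Suc m"
  shows "\<bar>e \<bullet> f\<bar> \<le> u i \<bullet> v i \<and> u i \<bullet> v i \<le> 1"
proof -
  have Sc: "a \<in> carrier_vec n" if "a \<in> span S" for a using span_closed[OF S that] .
  have eu: "e \<bullet> u = 0" "f \<bullet> u = 0" if "u \<in> span S" for u
    using e(3)[OF that] f(3)[OF that] comm_scalar_prod[OF e(1) Sc[OF that]] comm_scalar_prod[OF f(1) Sc[OF that]]
    by simp_all
  have Vc: "a \<in> carrier_vec n" if "a \<in> E" for a using that Sc e(1) by (auto simp: E)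
  have Wc: "a \<in> carrier_vec n" if "a \<in> F" for a using that Sc f(1) by (auto simp: F)
  have SV: "a \<in> E" "a \<in> F" if "a \<in> span S" for a
    unfolding E F using that S e(1) f(1) by (intro mem_span_add_line; simp)+
  have scale: "c \<cdot>\<^sub>v e \<in> E" "c \<cdot>\<^sub>v f \<in> F" for c
    unfolding E F using e(1) f(1) by (intro smult_mem_span_add_line; simp)+
  \<comment> \<open>Otherwise \<open>e\<close> would be \<open>f\<close> or its negative, and the
    two extensions would coincide.\<close>
  have ne: "(e \<bullet> f)\<^sup>2 \<noteq> 1"
  proof
    assume sq: "(e \<bullet> f)\<^sup>2 = 1"
    define t where "t = e \<bullet> f"
    have t: "t * t = 1" using sq by (simp add: t_def power2_eq_square)
    have "e = t \<cdot>\<^sub>v f"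
    proof (rule unit_vectors_eqI[of _ n])
      show "1 \<le> e \<bullet> (t \<cdot>\<^sub>v f)" using e f t by (simp add: t_def)
    qed (use e f t in auto)
    then have et: "c \<cdot>\<^sub>v e = (c * t) \<cdot>\<^sub>v f" for c by (simp add: smult_smult_assoc)
    have ft: "c \<cdot>\<^sub>v f = (c * t) \<cdot>\<^sub>v e" for c
      unfolding et using t by (simp add: mult.assoc)
    have "u + c \<cdot>\<^sub>v e \<in> F" if "u \<in> span S" for u c
      unfolding F et[of c] using that by blast
    moreover have "u + c \<cdot>\<^sub>v f \<in> E" if "u \<in> span S" for u c
      unfolding E ft[of c] using that by blast
    ultimately have "E = F" unfolding E F by blast
    with \<open>E \<noteq> F\<close> show False by simp
  qed
  \<comment> \<open>Scalar products with \<open>e\<close> and \<open>f\<close> give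
    \<open>c = d * (e \<bullet> f)\<close> and \<open>d = c * (e \<bullet> f)\<close>, hence
    \<open>c * (1 - (e \<bullet> f)\<^sup>2) = 0\<close> and \<open>c = 0\<close>.\<close>
  have inter: "a \<in> span S" if a: "a \<in> E" "a \<in> F" for a
  proof -
    obtain x c where x: "x \<in> span S" "a = x + c \<cdot>\<^sub>v e" using a(1) E by auto
    obtain y d where y: "y \<in> span S" "a = y + d \<cdot>\<^sub>v f" using a(2) F by auto
    have xc: "x \<in> carrier_vec n" "y \<in> carrier_vec n" using x y Sc by auto
    have "a \<bullet> e = c" unfolding x(2) using e(1,2) xc e(3)[OF x(1)] by (simp add: add_scalar_prod_distrib[of _ n])
    moreover have "a \<bullet> f = c * (e \<bullet> f)"
      unfolding x(2) using e(1) f(1) xc f(3)[OF x(1)] by (simp add: add_scalar_prod_distrib[of _ n])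
    moreover have "a \<bullet> f = d" unfolding y(2) using f(1,2) xc f(3)[OF y(1)] by (simp add: add_scalar_prod_distrib[of _ n])
    moreover have "a \<bullet> e = d * (e \<bullet> f)"
      unfolding y(2) using e(1) f(1) xc e(3)[OF y(1)] comm_scalar_prod[OF e(1) f(1)]
      by (simp add: add_scalar_prod_distrib[of _ n])
    ultimately have "c * (1 - (e \<bullet> f)\<^sup>2) = 0" by (simp add: power2_eq_square algebra_simps)
    then have "c = 0" using ne by simp
    then have "a = x" using x xc e(1) by (auto simp: vec_eq_iff)
    then show ?thesis using x by simp
  qed
  define U where "U i = {a \<in> E. l2_norm_vec a = 1 \<and> (\<forall>j<i. a \<bullet> u j = 0)}" for i
  define Z where "Z i = {b \<in> F. l2_norm_vec b = 1 \<and> (\<forall>j<i. b \<bullet> v j = 0)}" for i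
  have P: "u i \<in> U i" "v i \<in> Z i" "\<And>a b. a \<in> U i \<Longrightarrow> b \<in> Z i \<Longrightarrow> a \<bullet> b \<le> u i \<bullet> v i" if "i < Suc m" for i
    using uv that by (auto simp: principal_vectors_def Let_def U_def Z_def)
  have uc: "u i \<in> E" "u i \<in> carrier_vec n" "u i \<bullet> u i = 1" if "i < Suc m" for i
    using P(1)[OF that] Vc by (auto simp: U_def l2_norm_vec_eq_1_iff)
  have vc: "v i \<in> F" "v i \<in> carrier_vec n" "v i \<bullet> v i = 1" if "i < Suc m" for i
    using P(2)[OF that] Wc by (auto simp: Z_def l2_norm_vec_eq_1_iff)
  \<comment> \<open>By induction the earlier pairs coincide, so a unit vector \<open>y\<close> of
    \<open>span S\<close> orthogonal to them is admissible on both sides. Since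
    \<open>y \<bullet> y = 1\<close>, the maximum is 1 and \<open>u i = v i\<close>, a vector of the
    intersection.\<close>
  have common: "u i = v i \<and> u i \<in> span S" if "i < m" for i
    using that
  proof (induction i rule: less_induct)
    case (less i)
    have "\<exists>y\<in>span S. y \<bullet> y = 1 \<and> (\<forall>j<i. y \<bullet> u j = 0)"
      using less.prems by (intro orthonormal_basis_exists_orthogonal[OF S w] uc) auto
    then obtain y where y: "y \<in> span S" "y \<bullet> y = 1" "\<forall>j<i. y \<bullet> u j = 0" by blast
    have "y \<in> U i" using y SV by (simp add: U_def l2_norm_vec_eq_1_iff)
    moreover have "y \<in> Z i" using y SV less by (auto simp: Z_def l2_norm_vec_eq_1_iff)
    ultimately have "1 \<le> u i \<bullet> v i" using P(3)[of i y y] y(2) less.prems by simp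
    then have "u i = v i"
      using unit_vectors_eqI[of "u i" n "v i"] uc vc less.prems by auto
    moreover have "v i \<in> F" using vc less.prems by simp
    ultimately show ?case using inter[of "u i"] uc(1)[of i] less.prems by auto
  qed
  have le: "\<bar>e \<bullet> f\<bar> \<le> 1" using abs_scalar_prod_le_1 e f by blast
  show ?thesis
  proof (cases "i < m")
    case True
    then show ?thesis using common[OF True] uc(3)[of i] le by simp
  next
    case False
    then have im: "i = m" using i by simp
    have common': "u j \<in> span S" "v j \<in> span S" if "j < m" for j using common[OF that] by auto
    have et: "e \<in> U m"
      using scale(1)[of 1] e common'
      by (auto simp: U_def l2_norm_vec_eq_1_iff eu)
    have "\<bar>e \<bullet> f\<bar> \<le> u m \<bullet> v m"
    proof -
      \<comment> \<open>The sign makes \<open>e \<bullet> (t \<cdot>\<^sub>v f)\<close> equal to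
        \<open>\<bar>e \<bullet> f\<bar>\<close>.\<close>
      define t :: real where "t = (if e \<bullet> f \<ge> 0 then 1 else -1)"
      have "t \<cdot>\<^sub>v f \<in> Z m"
        using scale(2)[of t] f common'
        by (auto simp: Z_def t_def l2_norm_vec_eq_1_iff eu Sc)
      then have "e \<bullet> (t \<cdot>\<^sub>v f) \<le> u m \<bullet> v m" using P(3)[of m, OF _ et] by simp
      then show ?thesis using e f by (simp add: t_def split: if_splits)
    qed
    moreover have "u m \<bullet> v m \<le> 1"
      using abs_scalar_prod_le_1[of "u m" n "v m"] uc[of m] vc[of m] by simp
    ultimately show ?thesis using im by simp
  qed
qed

text \<open>\<open>principal_angles\<close> is a choice, so it is informative only once some
  principal vectors exist. The witnesses are \<open>w\<close> continued by \<open>e\<close> on one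
  side and by \<open>f\<close>, with a suitable sign, on the other.\<close>

lemma principal_vectors_adjacent_exist:
  assumes S: "S \<subseteq> carrier_vec n" and w: "orthonormal_basis m w (span S)"
    and e: "e \<in> carrier_vec n" "e \<bullet> e = 1" "\<And>u. u \<in> span S \<Longrightarrow> u \<bullet> e = 0"
    and f: "f \<in> carrier_vec n" "f \<bullet> f = 1" "\<And>u. u \<in> span S \<Longrightarrow> u \<bullet> f = 0"
    and E: "E = {u + c \<cdot>\<^sub>v e | u c. u \<in> span S}" and F: "F = {u + c \<cdot>\<^sub>v f | u c. u \<in> span S}"
  shows "\<exists>u v. principal_vectors (Suc m) E F u v"
proof -
  have Sc: "a \<in> carrier_vec n" if "a \<in> span S" for a using span_closed[OF S that] .
  have eu: "e \<bullet> u = 0" "f \<bullet> u = 0" if "u \<in> span S" for u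
    using e(3)[OF that] f(3)[OF that] comm_scalar_prod[OF e(1) Sc[OF that]] comm_scalar_prod[OF f(1) Sc[OF that]]
    by simp_all
  have Vc: "a \<in> carrier_vec n" if "a \<in> E" for a using that Sc e(1) by (auto simp: E)
  have Wc: "a \<in> carrier_vec n" if "a \<in> F" for a using that Sc f(1) by (auto simp: F)
  have SV: "a \<in> E" "a \<in> F" if "a \<in> span S" for a
    unfolding E F using that S e(1) f(1) by (intro mem_span_add_line; simp)+
  have scale: "c \<cdot>\<^sub>v e \<in> E" "c \<cdot>\<^sub>v f \<in> F" for c
    unfolding E F using e(1) f(1) by (intro smult_mem_span_add_line; simp)+
  have wS: "w j \<in> span S" "w j \<in> carrier_vec n" if "j < m" for j
    using w that Sc by (auto simp: orthonormal_basis_def)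
  have ww: "w i \<bullet> w j = (if i = j then 1 else 0)" if "i < m" "j < m" for i j
    using w that by (simp add: orthonormal_basis_def)
  define t :: real where "t = (if e \<bullet> f \<ge> 0 then 1 else -1)"
  have tf: "t \<cdot>\<^sub>v f \<in> carrier_vec n" using f by simp
  define u where "u = w(m := e)"
  define v where "v = w(m := t \<cdot>\<^sub>v f)"
  \<comment> \<open>Once the directions \<open>w j\<close> are used up, only the unit vectors
    \<open>g\<close> and \<open>-g\<close> of the extension remain; this makes the last maximisation
    explicit.\<close>
  have line: "\<exists>c. c\<^sup>2 = 1 \<and> a = c \<cdot>\<^sub>v g"
    if g: "g \<in> carrier_vec n" "g \<bullet> g = 1" "\<And>u. u \<in> span S \<Longrightarrow> u \<bullet> g = 0"
      and a: "a \<in> {u + c \<cdot>\<^sub>v g | u c. u \<in> span S}" "a \<bullet> a = 1" "\<And>j. j < m \<Longrightarrow> a \<bullet> w j = 0" for a g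
  proof -
    obtain x c where x: "x \<in> span S" and ax: "a = x + c \<cdot>\<^sub>v g" using a(1) by auto
    have "w j \<bullet> x = 0" if "j < m" for j
    proof -
      have "a \<bullet> w j = x \<bullet> w j"
        unfolding ax using g(1) g(3)[OF wS(1)[OF that]] comm_scalar_prod[OF g(1) wS(2)[OF that]] Sc[OF x] wS(2)[OF that]
        by (simp add: add_scalar_prod_distrib[of _ n])
      then show ?thesis using a(3)[OF that] comm_scalar_prod[OF Sc[OF x] wS(2)[OF that]] by simp
    qed
    then have "x = 0\<^sub>v n" using x w by (simp add: orthonormal_basis_def)
    then have "a = c \<cdot>\<^sub>v g" using ax g by simp
    then show ?thesis using a(2) g(1,2) by (auto simp: power2_eq_square)
  qed
  have "principal_vectors (Suc m) E F u v"
    unfolding principal_vectors_def Let_def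
  proof (intro allI impI conjI ballI)
    fix i assume i: "i < Suc m"
    show "u i \<in> {a \<in> E. l2_norm_vec a = 1 \<and> (\<forall>j<i. a \<bullet> u j = 0)}"
      using i scale(1)[of 1] e wS ww SV
      by (auto simp: u_def l2_norm_vec_eq_1_iff less_Suc_eq eu)
    have "t * t = 1" by (simp add: t_def)
    then show "v i \<in> {a \<in> F. l2_norm_vec a = 1 \<and> (\<forall>j<i. a \<bullet> v j = 0)}"
      using i scale(2)[of t] f wS ww SV
      by (auto simp: v_def l2_norm_vec_eq_1_iff less_Suc_eq eu)
    fix a b assume a: "a \<in> {a \<in> E. l2_norm_vec a = 1 \<and> (\<forall>j<i. a \<bullet> u j = 0)}"
      and b: "b \<in> {b \<in> F. l2_norm_vec b = 1 \<and> (\<forall>j<i. b \<bullet> v j = 0)}"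
    show "a \<bullet> b \<le> u i \<bullet> v i"
    proof (cases "i = m")
      case False
      then have "u i \<bullet> v i = 1" using i ww by (simp add: u_def v_def)
      moreover have "a \<bullet> b \<le> 1"
        using abs_scalar_prod_le_1[of a n b] a b Vc Wc by (auto simp: l2_norm_vec_eq_1_iff)
      ultimately show ?thesis by simp
    next
      case True
      have "\<exists>c. c\<^sup>2 = 1 \<and> a = c \<cdot>\<^sub>v e"
        using a True by (intro line e) (auto simp: E u_def l2_norm_vec_eq_1_iff)
      moreover have "\<exists>c. c\<^sup>2 = 1 \<and> b = c \<cdot>\<^sub>v f"
        using b True by (intro line f) (auto simp: F v_def l2_norm_vec_eq_1_iff)
      ultimately obtain c d where c: "c\<^sup>2 = 1" "a = c \<cdot>\<^sub>v e" and d: "d\<^sup>2 = 1" "b = d \<cdot>\<^sub>v f" by auto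
      have "c = 1 \<or> c = -1" "d = 1 \<or> d = -1" using c d by (auto simp: power2_eq_1_iff)
      moreover have "a \<bullet> b = c * d * (e \<bullet> f)" using c d e f by simp
      ultimately have "a \<bullet> b \<le> \<bar>e \<bullet> f\<bar>" by auto
      also have "\<dots> = u i \<bullet> v i" using True e f by (simp add: u_def v_def t_def)
      finally show ?thesis .
    qed
  qed
  then show ?thesis by blast
qed

text \<open>\<open>principal_vectors_adjacent\<close> covers every choice of principal vectors,
  hence also the one behind \<open>principal_angles\<close>. The direction \<open>\<le>\<close>
  turns a lower bound on the distance into an upper bound on
  \<open>\<bar>e \<bullet> f\<bar>\<close>.\<close>

lemma max_chordal_distance_adjacent:
  assumes S: "S \<subseteq> carrier_vec n" and w: "orthonormal_basis m w (span S)"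
    and e: "e \<in> carrier_vec n" "e \<bullet> e = 1" "\<And>u. u \<in> span S \<Longrightarrow> u \<bullet> e = 0"
    and f: "f \<in> carrier_vec n" "f \<bullet> f = 1" "\<And>u. u \<in> span S \<Longrightarrow> u \<bullet> f = 0"
    and E: "E = {u + c \<cdot>\<^sub>v e | u c. u \<in> span S}" and F: "F = {u + c \<cdot>\<^sub>v f | u c. u \<in> span S}"
    and "E \<noteq> F"
  shows "max_chordal_distance (Suc m) E F \<le> sqrt (1 - (e \<bullet> f)\<^sup>2)"
proof -
  obtain u0 v0 where "principal_vectors (Suc m) E F u0 v0"
    using principal_vectors_adjacent_exist[OF assms(1-10)] by blast
  then have "\<exists>\<theta>s u v. principal_vectors (Suc m) E F u v \<and> \<theta>s = rev (map (\<lambda>i. arccos (u i \<bullet> v i)) [0..<Suc m])"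
    by (intro exI conjI) (assumption, rule refl)
  from someI_ex[OF this] obtain u v where uv: "principal_vectors (Suc m) E F u v"
    and eq: "principal_angles (Suc m) E F = rev (map (\<lambda>i. arccos (u i \<bullet> v i)) [0..<Suc m])"
    unfolding principal_angles_def by (elim exE conjE)
  have "sin (arccos (u i \<bullet> v i)) \<le> sqrt (1 - (e \<bullet> f)\<^sup>2)" if "i < Suc m" for i
    using principal_vectors_adjacent[OF assms(1-10) \<open>E \<noteq> F\<close> uv that] by (intro sin_arccos_le) simp_all
  moreover have "set (principal_angles (Suc m) E F) = (\<lambda>i. arccos (u i \<bullet> v i)) ` {..<Suc m}"
    unfolding eq by (simp only: set_rev set_map set_upt atLeast0LessThan)
  ultimately show ?thesis
    unfolding max_chordal_distance_def by (subst Max_le_iff) (simp_all add: image_image lessThan_empty_iff del: sin_arccos)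
qed

end

section \<open>Columns and spark\<close>

lemma pick_image:
  assumes "finite J"
  shows "pick J ` {..<card J} = J"
proof (intro equalityI subsetI)
  fix j assume "j \<in> pick J ` {..<card J}"
  then obtain k where "k < card J" "j = pick J k" by auto
  then show "j \<in> J" by (simp add: pick_in_set_le)
next
  fix j assume j: "j \<in> J"
  have "{a \<in> J. a < j} \<subset> J" using j by auto
  then have "card {a \<in> J. a < j} < card J" using assms psubset_card_mono by blast
  then show "j \<in> pick J ` {..<card J}"
    by (intro image_eqI[of _ _ "card {a \<in> J. a < j}"]) (simp_all add: pick_card_in_set[OF j])
qed

lemma
  assumes A: "A \<in> carrier_mat n p" and J: "J \<subseteq> {..<p}"
  shows submatrix_cols_carrier: "submatrix A UNIV J \<in> carrier_mat n (card J)"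
    and set_cols_submatrix: "set (cols (submatrix A UNIV J)) = col A ` J"
proof -
  have c: "card {j. j < p \<and> j \<in> J} = card J" using J by (intro arg_cong[of _ _ card]) auto
  show M: "submatrix A UNIV J \<in> carrier_mat n (card J)"
    using A c by (intro carrier_matI) (simp_all add: dim_submatrix)
  have "col (submatrix A UNIV J) k = col A (pick J k)" if "k < card J" for k
  proof (rule eq_vecI)
    have k: "pick J k < p" using pick_in_set_le[OF that] J by auto
    fix i assume "i < dim_vec (col A (pick J k))"
    then have i: "i < n" using A by simp
    have "submatrix A UNIV J $$ (i, k) = A $$ (pick UNIV i, pick J k)"
      using A that i c by (intro submatrix_index) simp_all
    then show "col (submatrix A UNIV J) k $ i = col A (pick J k) $ i"
      using A M that k i by (simp add: pick_UNIV)
  qed (use A M in simp)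
  moreover have "set (cols (submatrix A UNIV J)) = col (submatrix A UNIV J) ` {..<card J}"
    using M by (simp add: cols_def atLeast0LessThan)
  ultimately have "set (cols (submatrix A UNIV J)) = (\<lambda>k. col A (pick J k)) ` {..<card J}"
    by simp
  also have "\<dots> = col A ` (pick J ` {..<card J})" by (simp add: image_image)
  also have "pick J ` {..<card J} = J" by (rule pick_image) (rule finite_subset[OF J finite_lessThan])
  finally show "set (cols (submatrix A UNIV J)) = col A ` J" .
qed

context real_vec_space
begin

lemma rank_submatrix_of_less_spark:
  assumes A: "A \<in> carrier_mat n p" and J: "J \<subseteq> {..<p}" "J \<noteq> {}" and "enat (card J) < spark A"
  shows "card J \<le> rank (submatrix A UNIV J)"
proof (rule ccontr)
  assume "\<not> ?thesis"
  moreover have "0 < card J" using J finite_subset[OF J(1) finite_lessThan] by (simp add: card_gt_0_iff)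
  ultimately have "spark A \<le> enat (card J)"
    unfolding spark_def using A J
    by (intro INF_lower CollectI conjI exI[of _ J]) simp_all
  then show False using assms by simp
qed

text \<open>The submatrix on \<open>insert i J\<close> has full column rank. Since the rank is the
  size of a maximal independent subset of the set of columns, that subset is the whole set, so the
  columns are independent.\<close>

lemma col_notin_span_of_less_spark:
  assumes A: "A \<in> carrier_mat n p" and J: "insert i J \<subseteq> {..<p}" "i \<notin> J"
    and spark: "enat (Suc (card J)) < spark A"
  shows "col A i \<notin> span (col A ` J)"
proof
  assume i: "col A i \<in> span (col A ` J)"
  define C where "C = col A ` insert i J"
  have "finite J" using finite_subset[OF J(1)] by simp
  then have cardJ: "card (insert i J) = Suc (card J)" using J by simp
  have C: "C \<subseteq> carrier_vec n" "finite C" using A J \<open>finite J\<close> by (auto simp: C_def)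
  have cols: "set (cols (submatrix A UNIV (insert i J))) = C"
    unfolding C_def by (rule set_cols_submatrix[OF A J(1)])
  obtain S where S: "maximal S (\<lambda>T. T \<subseteq> C \<and> lin_indpt T)"
    using maximal_exists[of "(\<lambda>T. T \<subseteq> C \<and> lin_indpt T)" "card C" "{}"] C(2)
    by (meson card_mono empty_iff empty_subsetI finite_lin_indpt2 rev_finite_subset)
  then have SC: "S \<subseteq> C" "lin_indpt S" by (auto simp: maximal_def)
  have "Suc (card J) \<le> rank (submatrix A UNIV (insert i J))"
    using rank_submatrix_of_less_spark[OF A J(1)] spark cardJ by simp
  also have "\<dots> = card S"
    using rank_card_indpt[OF submatrix_cols_carrier[OF A J(1)]] S cols by simp
  finally have le: "Suc (card J) \<le> card S" .
  have "card S \<le> card C" using SC C by (intro card_mono) auto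
  moreover have "card C \<le> Suc (card J)"
    unfolding C_def cardJ[symmetric] using \<open>finite J\<close> by (intro card_image_le) simp
  ultimately have eq: "card S = card C" "card C = card (insert i J)" using le cardJ by auto
  then have "S = C" using SC C card_subset_eq by blast
  then have "lin_indpt C" using SC by simp
  \<comment> \<open>Columns are collected in a set, so a repetition of \<open>col A i\<close> within
    \<open>J\<close> must be excluded before it can be removed from \<open>C\<close>.\<close>
  moreover have "inj_on (col A) (insert i J)"
    using eq(2) \<open>finite J\<close> unfolding C_def by (intro eq_card_imp_inj_on) auto
  then have "C - {col A i} = col A ` J" using J(2) unfolding C_def by (auto simp: inj_on_def)
  then have "lin_dep C" unfolding lindep_span[OF C] using i by (intro bexI[of _ "col A i"]) (simp_all add: C_def)
  ultimately show False by simp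
qed

section \<open>The bound on the number of columns for fixed \<open>n\<close>\<close>

text \<open>The summand \<open>m\<close> counts the columns shared by all the subspaces considered;
  each of the other \<open>p - m\<close> columns contributes one unit vector in the complement of
  their span, of dimension \<open>n - m\<close>.\<close>

lemma card_cols_bound_of_separated:
  assumes X: "X \<in> carrier_mat n p" and s: "s = Suc m" "s \<le> n" "2 * enat s < spark X"
    and \<delta>: "0 < \<delta>" "2 * \<delta> < 1"
    and sep: "\<And>E F. E \<in> spanned_subspaces s X \<Longrightarrow> F \<in> spanned_subspaces s X \<Longrightarrow> E \<noteq> F
      \<Longrightarrow> 2 * \<delta> \<le> max_chordal_distance s E F"
  shows "real p \<le> real m + 2 * inverse \<delta> ^ (n - m)"
proof (cases "p \<le> m")
  case True
  then show ?thesis using \<delta> by (simp add: add_increasing2)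
next
  case False
  define x where "x = col X"
  have x: "x j \<in> carrier_vec n" if "j < p" for j using X that by (simp add: x_def)
  have "2 * enat s = enat (2 * s)" by (simp add: numeral_eq_enat)
  \<comment> \<open>Up to \<open>s\<close> columns and one more are at most \<open>2 * s\<close>
    columns, as \<open>s\<close> is positive, and this is below the spark.\<close>
  then have indep: "x i \<notin> span (x ` J)" if "insert i J \<subseteq> {..<p}" "i \<notin> J" "card J \<le> s" for i J
  proof -
    have "Suc (card J) \<le> 2 * s" using that(3) s(1) by simp
    then have "enat (Suc (card J)) < spark X"
      using s(3) \<open>2 * enat s = enat (2 * s)\<close> by (metis enat_ord_simps(1) order_le_less_trans)
    then show ?thesis unfolding x_def using col_notin_span_of_less_spark[OF X that(1,2)] by blast
  qed
  define S where "S = x ` {..<m}"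
  have S: "S \<subseteq> carrier_vec n" using x False by (auto simp: S_def)
  have "\<exists>w. orthonormal_basis m w (span S)"
    unfolding S_def using False s by (intro gram_schmidt_orthonormal_basis x indep) auto
  then obtain w where w: "orthonormal_basis m w (span S)" by blast
  have wS: "w j \<in> span S" if "j < m" for j
    using w that by (simp add: orthonormal_basis_def)
  have wc: "w j \<in> carrier_vec n" if "j < m" for j
    using span_closed[OF S wS[OF that]] .
  have ww: "w i \<bullet> w j = (if i = j then 1 else 0)" if "i < m" "j < m" for i j
    using w that by (simp add: orthonormal_basis_def)
  have "\<forall>i\<in>{m..<p}. \<exists>e. e \<in> carrier_vec n \<and> e \<bullet> e = 1 \<and> (\<forall>u\<in>span S. u \<bullet> e = 0) \<and>
      span (insert (x i) S) = {u + c \<cdot>\<^sub>v e | u c. u \<in> span S}"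
  proof
    fix i assume i: "i \<in> {m..<p}"
    have xi: "x i \<in> carrier_vec n" using x i by simp
    have "x i \<notin> span S" unfolding S_def using i s by (intro indep) auto
    then show "\<exists>e. e \<in> carrier_vec n \<and> e \<bullet> e = 1 \<and> (\<forall>u\<in>span S. u \<bullet> e = 0) \<and>
      span (insert (x i) S) = {u + c \<cdot>\<^sub>v e | u c. u \<in> span S}"
      by (rule orthonormal_basis_insert[OF S w xi]) (intro exI conjI ballI; assumption)
  qed
  from bchoice[OF this] obtain e where eall: "\<forall>i\<in>{m..<p}. e i \<in> carrier_vec n \<and> e i \<bullet> e i = 1 \<and> (\<forall>u\<in>span S. u \<bullet> e i = 0) \<and>
      span (insert (x i) S) = {u + c \<cdot>\<^sub>v e i | u c. u \<in> span S}" ..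
  have e: "e i \<in> carrier_vec n" "e i \<bullet> e i = 1" "\<And>u. u \<in> span S \<Longrightarrow> u \<bullet> e i = 0"
    and E: "span (insert (x i) S) = {u + c \<cdot>\<^sub>v e i | u c. u \<in> span S}" if "i \<in> {m..<p}" for i
    using bspec[OF eall that] by simp_all
  have ins: "insert (x i) S = x ` insert i {..<m}" for i by (simp add: S_def)
  have spanned: "span (insert (x i) S) \<in> spanned_subspaces s X" if "i \<in> {m..<p}" for i
  proof -
    have J: "insert i {..<m} \<subseteq> {..<p}" "card (insert i {..<m}) = s" using that s by auto
    have "col_space (submatrix X UNIV (insert i {..<m})) = span (insert (x i) S)"
      unfolding col_space_def set_cols_submatrix[OF X J(1)] ins by (simp only: x_def)
    then show ?thesis unfolding spanned_subspaces_def using J X by auto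
  qed
  \<comment> \<open>If the spans agreed, \<open>x j\<close> would lie in the span of
    \<open>s\<close> other columns, so \<open>s + 1\<close> columns would be dependent.\<close>
  have distinct: "span (insert (x i) S) \<noteq> span (insert (x j) S)"
    if ij: "i \<in> {m..<p}" "j \<in> {m..<p}" "i \<noteq> j" for i j
  proof
    assume "span (insert (x i) S) = span (insert (x j) S)"
    moreover have "x j \<in> span (insert (x j) S)"
      using S x ij by (intro span_mem) auto
    ultimately have "x j \<in> span (x ` insert i {..<m})" using ins by simp
    moreover have "x j \<notin> span (x ` insert i {..<m})" using ij s by (intro indep) auto
    ultimately show False by simp
  qed
  have angle: "e i \<bullet> e j \<le> sqrt (1 - (2 * \<delta>)\<^sup>2)"
    if ij: "i \<in> {m..<p}" "j \<in> {m..<p}" "i \<noteq> j" for i j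
  proof -
    have "2 * \<delta> \<le> max_chordal_distance (Suc m) (span (insert (x i) S)) (span (insert (x j) S))"
      using sep[OF spanned[OF ij(1)] spanned[OF ij(2)] distinct[OF ij]] s(1) by simp
    also have "\<dots> \<le> sqrt (1 - (e i \<bullet> e j)\<^sup>2)"
      using max_chordal_distance_adjacent[OF S w e[OF ij(1)] e[OF ij(2)] E[OF ij(1)] E[OF ij(2)] distinct[OF ij]] .
    finally have *: "2 * \<delta> \<le> sqrt (1 - (e i \<bullet> e j)\<^sup>2)" .
    \<comment> \<open>\<open>sqrt\<close> is negative at negative arguments, so the sign of the
      radicand is settled before squaring.\<close>
    moreover have "0 < sqrt (1 - (e i \<bullet> e j)\<^sup>2)" using * \<delta> by linarith
    then have "0 < 1 - (e i \<bullet> e j)\<^sup>2" by (simp only: real_sqrt_gt_0_iff)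
    ultimately have "(2 * \<delta>)\<^sup>2 \<le> 1 - (e i \<bullet> e j)\<^sup>2"
      using power_mono[OF *, of 2] \<delta> by simp
    then have "(e i \<bullet> e j)\<^sup>2 \<le> 1 - (2 * \<delta>)\<^sup>2" by simp
    then show ?thesis by (rule real_le_rsqrt)
  qed
  define d where "d = n - m"
  have md: "m + d = n" using s by (simp add: d_def)
  have "\<exists>b. (\<forall>i<d. b i \<in> carrier_vec n) \<and> (\<forall>i<d. \<forall>j<d. b i \<bullet> b j = (if i = j then 1 else 0))
    \<and> (\<forall>j<m. \<forall>i<d. w j \<bullet> b i = 0)"
    by (rule exists_orthonormal_orthogonal) (simp_all add: md wc)
  then obtain b where b: "\<forall>i<d. b i \<in> carrier_vec n" "\<forall>i<d. \<forall>j<d. b i \<bullet> b j = (if i = j then 1 else 0)"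
    "\<forall>j<m. \<forall>i<d. w j \<bullet> b i = 0" by (elim exE conjE)
  \<comment> \<open>An orthonormal basis of the whole space: \<open>w\<close> for the common span,
    followed by \<open>b\<close> for its complement.\<close>
  define g where "g k = (if k < m then w k else b (k - m))" for k
  have g: "g k \<in> carrier_vec n" if "k < n" for k using that b(1) wc md by (auto simp: g_def)
  have bw: "b i \<bullet> w j = 0" if "i < d" "j < m" for i j
    using b(1,3) that comm_scalar_prod[of "b i" n "w j"] wc by simp
  have gg: "g i \<bullet> g j = (if i = j then 1 else 0)" if "i < n" "j < n" for i j
    using that b(2,3) bw ww md by (auto simp: g_def)
  \<comment> \<open>The coordinates of \<open>e i\<close> along \<open>w\<close> vanish, so its
    \<open>d\<close> coordinates along \<open>b\<close> carry all scalar products; these coordinate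
    vectors are the ones packed below.\<close>
  have prod: "(\<Sum>k<d. (b k \<bullet> e i) * (b k \<bullet> e j)) = e i \<bullet> e j"
    if ij: "i \<in> {m..<p}" "j \<in> {m..<p}" for i j
  proof -
    have "e i \<bullet> e j = (\<Sum>k<m + d. (g k \<bullet> e i) * (g k \<bullet> e j))"
      unfolding md by (intro parseval_orthonormal g gg e ij)
    also have "\<dots> = (\<Sum>k<m. (g k \<bullet> e i) * (g k \<bullet> e j)) + (\<Sum>k<d. (g (m + k) \<bullet> e i) * (g (m + k) \<bullet> e j))"
      by (induction d) (auto simp: add.assoc)
    also have "(\<Sum>k<m. (g k \<bullet> e i) * (g k \<bullet> e j)) = 0"
      using e(3)[OF ij(1)] wS by (intro sum.neutral) (auto simp: g_def)
    finally show ?thesis by (simp add: g_def)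
  qed
  have "real (card {m..<p}) \<le> 2 * inverse \<delta> ^ card {..<d}"
  proof (rule unit_vectors_packing[OF _ _ \<delta>])
    show "(\<Sum>k<d. (b k \<bullet> e i)\<^sup>2) = 1" if "i \<in> {m..<p}" for i
      using prod[OF that that] e(2)[OF that] by (simp add: power2_eq_square)
    show "(\<Sum>k<d. (b k \<bullet> e i) * (b k \<bullet> e j)) \<le> sqrt (1 - (2 * \<delta>)\<^sup>2)"
      if "i \<in> {m..<p}" "j \<in> {m..<p}" "i \<noteq> j" for i j
      using angle[OF that] prod[OF that(1,2)] by simp
  qed auto
  then show ?thesis using False by (simp add: d_def of_nat_diff)
qed

end

section \<open>The asymptotic bound\<close>

text \<open>The logarithm of the packing bound is at most \<open>a n\<close>, and
  \<open>a n / n\<close> and \<open>b n / n\<close> have the same positive limit. Hence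
  \<open>a n / b n - 1\<close> tends to 0 and is the required relative error.\<close>

lemma asymp_dominated_of_packing_bound:
  fixes p s :: "nat \<Rightarrow> nat" and \<delta> \<gamma> :: real
  assumes \<delta>: "0 < \<delta>" "\<delta> < 1" and \<gamma>: "\<gamma> < 1"
    and ratio: "(\<lambda>n. real (s n) / real n) \<longlonglongrightarrow> \<gamma>"
    and s: "eventually (\<lambda>n. 0 < s n \<and> s n \<le> n) sequentially"
    and p: "eventually (\<lambda>n. real (p n) \<le> real (s n - 1) + 2 * inverse \<delta> ^ (n - (s n - 1))) sequentially"
  shows "asymp_dominated (\<lambda>n. ln (real (p n)))
    (\<lambda>n. ln (inverse \<delta>) * (1 - \<gamma>) * real n + 2 * ln (real n))"
proof -
  define L where "L = ln (inverse \<delta>)"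
  have inv: "inverse \<delta> > 1" using \<delta> by (simp add: one_less_inverse)
  then have L: "L > 0" unfolding L_def by (rule ln_gt_zero)
  \<comment> \<open>Logarithm of \<open>(n + 2) * inverse \<delta> ^ (n - s n + 1)\<close>: the
    additive \<open>s n - 1\<close> is absorbed into \<open>n\<close> times the power, which is at
    least 1.\<close>
  define a where "a n = ln (real n + 2) + L * (real n - real (s n) + 1)" for n
  define b where "b n = L * (1 - \<gamma>) * real n + 2 * ln (real n)" for n
  have "(\<lambda>n. ln (real n + 2) / real n + L * (1 - real (s n) / real n + 1 / real n)) \<longlonglongrightarrow> 0 + L * (1 - \<gamma> + 0)"
    by (intro tendsto_intros ratio; real_asymp)
  moreover have "eventually (\<lambda>n. ln (real n + 2) / real n + L * (1 - real (s n) / real n + 1 / real n) = a n / real n) sequentially"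
    using eventually_gt_at_top[of 0] by eventually_elim (simp add: a_def field_simps)
  ultimately have a: "(\<lambda>n. a n / real n) \<longlonglongrightarrow> L * (1 - \<gamma>)"
    by (simp add: tendsto_cong)
  have "(\<lambda>n. L * (1 - \<gamma>) + 2 * (ln (real n) / real n)) \<longlonglongrightarrow> L * (1 - \<gamma>) + 2 * 0"
    by (intro tendsto_intros; real_asymp)
  moreover have "eventually (\<lambda>n. L * (1 - \<gamma>) + 2 * (ln (real n) / real n) = b n / real n) sequentially"
    using eventually_gt_at_top[of 0] by eventually_elim (simp add: b_def field_simps)
  ultimately have b: "(\<lambda>n. b n / real n) \<longlonglongrightarrow> L * (1 - \<gamma>)"
    by (simp add: tendsto_cong)
  have pos: "L * (1 - \<gamma>) > 0" using L \<gamma> by simp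
  have "(\<lambda>n. (a n / real n) / (b n / real n) - 1) \<longlonglongrightarrow> L * (1 - \<gamma>) / (L * (1 - \<gamma>)) - 1"
    using L \<gamma> by (intro tendsto_intros a b) simp
  moreover have "eventually (\<lambda>n. (a n / real n) / (b n / real n) - 1 = a n / b n - 1) sequentially"
    using eventually_gt_at_top[of 0] by eventually_elim simp
  ultimately have "(\<lambda>n. a n / b n - 1) \<longlonglongrightarrow> L * (1 - \<gamma>) / (L * (1 - \<gamma>)) - 1"
    by (rule Lim_transform_eventually)
  then have lim: "(\<lambda>n. a n / b n - 1) \<longlonglongrightarrow> 0"
    using L \<gamma> by simp
  have small: "(\<lambda>n. a n / b n - 1) \<in> o(\<lambda>_. 1)"
    by (rule smalloI_tendsto) (use lim in simp_all)
  have bpos: "eventually (\<lambda>n. b n > 0) sequentially"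
    using eventually_gt_at_top[of 0]
  proof eventually_elim
    case (elim n)
    then have "L * (1 - \<gamma>) * real n > 0" "ln (real n) \<ge> 0" using pos by simp_all
    then show ?case by (simp add: b_def)
  qed
  have "eventually (\<lambda>n. ln (real (p n)) \<le> (1 + (a n / b n - 1)) * b n) sequentially"
    using bpos s p
  proof eventually_elim
    case (elim n)
    define k where "k = n - (s n - 1)"
    have k: "real k = real n - real (s n) + 1" using elim by (simp add: k_def of_nat_diff)
    have one: "1 \<le> inverse \<delta> ^ k" using inv by (simp add: one_le_power)
    have sn: "real (s n - 1) \<le> real n * inverse \<delta> ^ k"
      using elim one mult_mono[of "real (s n - 1)" "real n" 1 "inverse \<delta> ^ k"] by simp
    have le: "real (p n) \<le> (real n + 2) * inverse \<delta> ^ k"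
    proof -
      have "real (p n) \<le> real (s n - 1) + 2 * inverse \<delta> ^ k" using elim by (simp only: k_def)
      with sn show ?thesis unfolding distrib_right by linarith
    qed
    have eq: "ln ((real n + 2) * inverse \<delta> ^ k) = a n"
      using inv \<delta> by (subst ln_mult) (simp_all add: a_def k L_def ln_realpow mult.commute)
    have "ln (real (p n)) \<le> a n"
    \<comment> \<open>Here \<open>ln 0 = 0\<close>, so for \<open>p n = 0\<close> the claim is
      \<open>a n \<ge> 0\<close>.\<close>
    proof (cases "p n = 0")
      case True
      have "a n \<ge> 0" unfolding a_def k[symmetric] using L by simp
      then show ?thesis using True by simp
    next
      case False
      then show ?thesis unfolding eq[symmetric] using le by (subst ln_le_cancel_iff) auto
    qed
    then show ?case using elim by simp
  qed
  then show ?thesis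
    unfolding asymp_dominated_def b_def[symmetric] L_def[symmetric] using small
    by (intro bexI[of _ "\<lambda>n. a n / b n - 1"])
qed

theorem theorem3:
  fixes X :: "nat \<Rightarrow> real mat" and p s :: "nat \<Rightarrow> nat" and \<delta> \<gamma> :: real
  assumes dims: "eventually (\<lambda>n. X n \<in> carrier_mat n (p n)) sequentially"
    and norms: "eventually (\<lambda>n. \<forall>j<p n. l2_norm_vec (col (X n) j) = sqrt (real n)) sequentially"
    and s_spark: "eventually (\<lambda>n. 0 < s n \<and> 2 * enat (s n) < spark (X n)) sequentially"
    and delta: "0 < 2 * \<delta>" "2 * \<delta> < 1"
    and separated: "eventually (\<lambda>n. \<forall>V \<in> spanned_subspaces (s n) (X n).
          \<forall>W \<in> spanned_subspaces (s n) (X n).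
            V \<noteq> W \<longrightarrow> 2 * \<delta> \<le> max_chordal_distance (s n) V W) sequentially"
    and gamma: "0 < \<gamma>" "\<gamma> < 1 / 2"
    and s_ratio: "(\<lambda>n. real (s n) / real n) \<longlonglongrightarrow> \<gamma>"
  shows "\<exists>r \<in> O(\<lambda>_. 1). asymp_dominated (\<lambda>n. ln (real (p n)))
           (\<lambda>n. ln (inverse \<delta>) * (1 - \<gamma>) * real n + 2 * ln (real n) + r n)"
proof -
  \<comment> \<open>A limit below 1 makes \<open>s n \<le> n\<close> eventually, so that
    \<open>n - (s n - 1)\<close> is not truncated.\<close>
  have "eventually (\<lambda>n. real (s n) / real n < 1) sequentially"
    using order_tendstoD(2)[OF s_ratio, of 1] gamma by simp
  then have s: "eventually (\<lambda>n. 0 < s n \<and> s n \<le> n) sequentially"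
    using eventually_gt_at_top[of 0] s_spark by eventually_elim (auto simp: field_simps)
  have "eventually (\<lambda>n. real (p n) \<le> real (s n - 1) + 2 * inverse \<delta> ^ (n - (s n - 1))) sequentially"
    using dims s s_spark separated
  proof eventually_elim
    case (elim n)
    show ?case
    proof (rule real_vec_space.card_cols_bound_of_separated[of "X n" n "p n" "s n"])
      show "s n = Suc (s n - 1)" using elim by simp
    qed (use elim delta in auto)
  qed
  \<comment> \<open>The bounded term is taken to be identically 0.\<close>
  then have "asymp_dominated (\<lambda>n. ln (real (p n)))
      (\<lambda>n. ln (inverse \<delta>) * (1 - \<gamma>) * real n + 2 * ln (real n) + 0)"
    unfolding add_0_right using delta gamma s s_ratio
    by (intro asymp_dominated_of_packing_bound) auto
  moreover have "(\<lambda>_. 0 :: real) \<in> O(\<lambda>_. 1)" by simp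
  ultimately show ?thesis by (intro bexI[of _ "\<lambda>_. 0"])
qed

end
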